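(* Let $\lambda_2\oplus\mathbb{C}^2$ be the $5$-dimensional complex Leibniz algebra with basis $e_1,\dots,e_5$ and only nonzero bracket $[e_1,e_1]=e_3$. Then it deforms to the $5$-dimensional Leibniz algebra $\mu_1\oplus\mu_1\oplus\mathbb{C}$ in $6$ different ways, and it also deforms to $\mathfrak{L}_2\oplus\mathbb{C}$ and to $\mathfrak{R}_{20}(0)\oplus\mathbb{C}$. Here $\mu_1$ has basis $e_1,e_2$ and only nonzero bracket $[e_1,e_1]=e_2$; $\mathfrak{L}_2$ has basis $e_1,\dots,e_4$ and nonzero brackets $[e_1,e_2]=e_3=-[e_2,e_1]$, $[e_1,e_4]=e_1=-[e_4,e_1]$, $[e_4,e_2]=e_2=-[e_2,e_4]$, $[e_4,e_4]=e_3$; $\mathfrak{R}_{20}(0)$ has basis $e_1,\dots,e_4$ and nonzero brackets $[e_1,e_2]=e_4$, $[e_2,e_1]=e_4$, $[e_2,e_2]=e_3$; and $\mathbb{C}$ is the $1$-dimensional abelian algebra.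
   Context: All algebras are over $\mathbb{C}$. A left (resp. right) Leibniz algebra is a vector space $\mathfrak{L}$ with a bilinear bracket satisfying $[x,[y,z]]=[[x,y],z]+[y,[x,z]]$ (resp. $[x,[y,z]]=[[x,y],z]-[[x,z],y]$); a Leibniz algebra is one or the other. A (formal $1$-parameter, Leibniz) deformation of $(\mathfrak{L},\mu_0)$ is a Leibniz bracket $\mu_t=\mu_0+t\phi_1+t^2\phi_2+\cdots$ on $\mathfrak{L}\otimes\mathbb{C}[[t]]$, with $\phi_i$ bilinear maps $\mathfrak{L}\times\mathfrak{L}\to\mathfrak{L}$; $\phi_1$ is then a Leibniz $2$-cocycle. $\mathfrak{L}$ deforms to a Leibniz algebra $\mathfrak{N}$ if there is a deformation $\mu_t$, polynomial in $t$, with $(\mathfrak{L},\mu_t)\cong\mathfrak{N}$ for all nonzero $t$ near $0$. Deformations to $\mathfrak{N}$ are considered different ways of deforming when their infinitesimal parts $\phi_1$ are non-equivalent cocycles, i.e. have linearly independent classes modulo coboundaries $(x,y)\mapsto[x,f(y)]+[f(x),y]-f([x,y])$, $f$ linear. *)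

theory Defs
  imports "HOL-Analysis.Analysis" "HOL-Computational_Algebra.Formal_Power_Series"
begin

text \<open>
  Algebras are brackets on free modules \<open>'a ^ 'n\<close> over a commutative ring; the ring is
  \<open>complex\<close> for the algebras themselves and \<open>complex fps\<close>, that is \<open>\<complex>[[t]]\<close>, for their formal
  deformations. The basis vector \<open>e\<^sub>i\<close> is \<open>axis i 1\<close>. In a numeral index type such as \<open>5\<close> the
  elements are \<open>1, 2, 3, 4, 5\<close> with \<open>5 = 0\<close>, so the usual numbering of a basis may be kept.
\<close>

type_synonym ('a, 'n) bracket = "'a ^ 'n \<Rightarrow> 'a ^ 'n \<Rightarrow> 'a ^ 'n"

definition bilinear_bracket :: "('a::comm_ring_1, 'n::finite) bracket \<Rightarrow> bool" where
  "bilinear_bracket b \<longleftrightarrow>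
     (\<forall>x. module_hom (*s) (*s) (\<lambda>y. b x y)) \<and> (\<forall>y. module_hom (*s) (*s) (\<lambda>x. b x y))"

definition left_leibniz :: "('a::comm_ring_1, 'n::finite) bracket \<Rightarrow> bool" where
  "left_leibniz b \<longleftrightarrow> bilinear_bracket b \<and>
     (\<forall>x y z. b x (b y z) = b (b x y) z + b y (b x z))"

definition right_leibniz :: "('a::comm_ring_1, 'n::finite) bracket \<Rightarrow> bool" where
  "right_leibniz b \<longleftrightarrow> bilinear_bracket b \<and>
     (\<forall>x y z. b x (b y z) = b (b x y) z - b (b x z) y)"

definition leibniz :: "('a::comm_ring_1, 'n::finite) bracket \<Rightarrow> bool" where
  "leibniz b \<longleftrightarrow> left_leibniz b \<or> right_leibniz b"

definition leibniz_iso ::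
    "(complex, 'm::finite) bracket \<Rightarrow> (complex, 'n::finite) bracket \<Rightarrow> bool"
    (infix "\<cong>\<^sub>L" 50) where
  "b \<cong>\<^sub>L b' \<longleftrightarrow> (\<exists>f :: complex ^ 'm \<Rightarrow> complex ^ 'n.
     module_hom (*s) (*s) f \<and> bij f \<and> (\<forall>x y. f (b x y) = b' (f x) (f y)))"

definition bracket_of_table ::
    "('n \<Rightarrow> 'n \<Rightarrow> 'a ^ 'n) \<Rightarrow> ('a::comm_ring_1, 'n::finite) bracket" where
  "bracket_of_table c x y = (\<Sum>i\<in>UNIV. \<Sum>j\<in>UNIV. (x $ i * y $ j) *s c i j)"

definition direct_sum ::
    "('a, 'm::finite) bracket \<Rightarrow> ('a, 'n::finite) bracket \<Rightarrow> ('a, 'm + 'n) bracket"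
    (infixl "\<oplus>\<^sub>L" 65) where
  "(b \<oplus>\<^sub>L b') x y = (\<chi> i. case i of
       Inl p \<Rightarrow> b (\<chi> k. x $ Inl k) (\<chi> k. y $ Inl k) $ p
     | Inr q \<Rightarrow> b' (\<chi> k. x $ Inr k) (\<chi> k. y $ Inr k) $ q)"


text \<open>
  A deformation is given by the sequence \<open>\<phi>\<close> of coefficients in \<open>\<mu>\<^sub>t = \<phi> 0 + t \<phi> 1 + t\<^sup>2 \<phi> 2 + \<dots>\<close>.
  Since \<open>\<complex>\<^sup>n \<otimes> \<complex>[[t]] = \<complex>[[t]]\<^sup>n\<close>, its \<open>\<complex>[[t]]\<close>-bilinear extension is the bracket on
  \<open>complex fps ^ 'n\<close> whose structure constants are the power series with coefficients those of the
  \<open>\<phi> n\<close>.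
\<close>

definition formal_bracket ::
    "(nat \<Rightarrow> (complex, 'n::finite) bracket) \<Rightarrow> (complex fps, 'n) bracket" where
  "formal_bracket \<phi> = bracket_of_table
     (\<lambda>i j. \<chi> k. Abs_fps (\<lambda>n. \<phi> n (axis i 1) (axis j 1) $ k))"

definition formal_deformation ::
    "(complex, 'n::finite) bracket \<Rightarrow> (nat \<Rightarrow> (complex, 'n) bracket) \<Rightarrow> bool" where
  "formal_deformation \<mu> \<phi> \<longleftrightarrow> leibniz \<mu> \<and> \<phi> 0 = \<mu> \<and>
     (\<forall>n. bilinear_bracket (\<phi> n)) \<and> leibniz (formal_bracket \<phi>)"

definition polynomial_deformation ::
    "(complex, 'n::finite) bracket \<Rightarrow> (nat \<Rightarrow> (complex, 'n) bracket) \<Rightarrow> bool" where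
  "polynomial_deformation \<mu> \<phi> \<longleftrightarrow>
     formal_deformation \<mu> \<phi> \<and> finite {n. \<phi> n \<noteq> (\<lambda>x y. 0)}"

definition eval_deformation ::
    "(nat \<Rightarrow> (complex, 'n::finite) bracket) \<Rightarrow> complex \<Rightarrow> (complex, 'n) bracket" where
  "eval_deformation \<phi> t x y = (\<Sum>n | \<phi> n \<noteq> (\<lambda>x y. 0). t ^ n *s \<phi> n x y)"

definition deforms_via ::
    "(nat \<Rightarrow> (complex, 'n::finite) bracket) \<Rightarrow> (complex, 'n) bracket \<Rightarrow>
     (complex, 'm::finite) bracket \<Rightarrow> bool" where
  "deforms_via \<phi> \<mu> \<nu> \<longleftrightarrow> polynomial_deformation \<mu> \<phi> \<and> leibniz \<nu> \<and>
     (\<forall>\<^sub>F t in at 0. eval_deformation \<phi> t \<cong>\<^sub>L \<nu>)"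

definition deforms_to ::
    "(complex, 'n::finite) bracket \<Rightarrow> (complex, 'm::finite) bracket \<Rightarrow> bool" where
  "deforms_to \<mu> \<nu> \<longleftrightarrow> (\<exists>\<phi>. deforms_via \<phi> \<mu> \<nu>)"

definition coboundary ::
    "(complex, 'n::finite) bracket \<Rightarrow> (complex ^ 'n \<Rightarrow> complex ^ 'n) \<Rightarrow> (complex, 'n) bracket" where
  "coboundary \<mu> f x y = \<mu> x (f y) + \<mu> (f x) y - f (\<mu> x y)"

definition independent_mod_coboundaries ::
    "(complex, 'n::finite) bracket \<Rightarrow> nat \<Rightarrow> (nat \<Rightarrow> (complex, 'n) bracket) \<Rightarrow> bool" where
  "independent_mod_coboundaries \<mu> N \<psi> \<longleftrightarrow>
     (\<forall>c :: nat \<Rightarrow> complex.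
        (\<exists>f. module_hom (*s) (*s) f \<and>
             (\<lambda>x y. \<Sum>k<N. c k *s \<psi> k x y) = coboundary \<mu> f) \<longrightarrow>
        (\<forall>k<N. c k = 0))"

text \<open>
  \<open>N\<close> different ways of deforming are \<open>N\<close> deformations whose infinitesimal parts have linearly
  independent classes. This does not assert that no further such deformation exists.
\<close>

definition deforms_in_ways ::
    "nat \<Rightarrow> (complex, 'n::finite) bracket \<Rightarrow> (complex, 'm::finite) bracket \<Rightarrow> bool" where
  "deforms_in_ways N \<mu> \<nu> \<longleftrightarrow> (\<exists>\<Phi> :: nat \<Rightarrow> nat \<Rightarrow> (complex, 'n) bracket.
     (\<forall>k<N. deforms_via (\<Phi> k) \<mu> \<nu>) \<and> independent_mod_coboundaries \<mu> N (\<lambda>k. \<Phi> k 1))"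


definition lambda2_C2 :: "(complex, 5) bracket" where
  "lambda2_C2 = bracket_of_table (\<lambda>i j. if i = 1 \<and> j = 1 then axis 3 1 else 0)"

definition mu1 :: "(complex, 2) bracket" where
  "mu1 = bracket_of_table (\<lambda>i j. if i = 1 \<and> j = 1 then axis 2 1 else 0)"

definition L2 :: "(complex, 4) bracket" where
  "L2 = bracket_of_table (\<lambda>i j.
     if i = 1 \<and> j = 2 then axis 3 1
     else if i = 2 \<and> j = 1 then - axis 3 1
     else if i = 1 \<and> j = 4 then axis 1 1
     else if i = 4 \<and> j = 1 then - axis 1 1
     else if i = 4 \<and> j = 2 then axis 2 1
     else if i = 2 \<and> j = 4 then - axis 2 1
     else if i = 4 \<and> j = 4 then axis 3 1
     else 0)"

definition R20_0 :: "(complex, 4) bracket" where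
  "R20_0 = bracket_of_table (\<lambda>i j.
     if i = 1 \<and> j = 2 then axis 4 1
     else if i = 2 \<and> j = 1 then axis 4 1
     else if i = 2 \<and> j = 2 then axis 3 1
     else 0)"

definition abelian1 :: "(complex, 1) bracket" where
  "abelian1 = (\<lambda>x y. 0)"

end

theory Submission imports Defs begin

text \<open>
  All deformations used are linear in \<open>t\<close>. A coboundary of \<open>\<lambda>\<^sub>2 \<oplus> \<complex>\<^sup>2\<close> vanishes at \<open>(e\<^sub>p, e\<^sub>p)\<close> for
  \<open>p \<noteq> 1\<close>, because \<open>e\<^sub>p\<close> is central. Hence the six cochains sending \<open>(e\<^sub>p, e\<^sub>p)\<close> to \<open>e\<^sub>q\<close>, with
  \<open>p \<noteq> q\<close> in \<open>{2, 4, 5}\<close>, are independent modulo coboundaries, and adding \<open>t\<close> times one of them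
  creates a second copy of \<open>\<mu>\<^sub>1\<close>. For the other two targets \<open>e\<^sub>1\<close> is the basis vector whose square
  is \<open>e\<^sub>3\<close>, that is \<open>e\<^sub>4\<close> in \<open>\<LL>\<^sub>2\<close> and \<open>e\<^sub>2\<close> in \<open>\<RR>\<^sub>2\<^sub>0(0)\<close>, and the remaining brackets are
  switched on with factor \<open>t\<close>, which a rescaling of the basis removes when \<open>t \<noteq> 0\<close>.
\<close>

section \<open>Coordinates, linear maps and brackets given by tables\<close>

lemma exhaust_5: "(x::5) = 1 \<or> x = 2 \<or> x = 3 \<or> x = 4 \<or> x = 5"
proof (induct x)
  case (of_int z)
  then have "z = 0 \<or> z = 1 \<or> z = 2 \<or> z = 3 \<or> z = 4"
    by simp arith
  then show ?case by auto
qed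

lemma UNIV_5: "UNIV = {1, 2, 3, 4, 5 :: 5}"
  using exhaust_5 by auto

lemma sum_5: "sum f (UNIV::5 set) = f 1 + f 2 + f 3 + f 4 + f 5"
  unfolding UNIV_5 by (simp add: ac_simps)

lemma forall_5: "(\<forall>i::5. P i) \<longleftrightarrow> P 1 \<and> P 2 \<and> P 3 \<and> P 4 \<and> P 5"
  by (metis exhaust_5)

lemma module_hom_vecI:
  fixes f :: "'a::comm_ring_1 ^ 'm \<Rightarrow> 'a ^ 'n"
  assumes "\<And>x y. f (x + y) = f x + f y" "\<And>c x. f (c *s x) = c *s f x"
  shows "module_hom (*s) (*s) f"
  using assms
  by unfold_locales (simp_all add: vec_eq_iff algebra_simps)

lemma module_hom_vecD:
  fixes f :: "'a::comm_ring_1 ^ 'm \<Rightarrow> 'a ^ 'n"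
  assumes "module_hom (*s) (*s) f"
  shows "f (x + y) = f x + f y" "f (c *s x) = c *s f x" "f 0 = 0"
  using module_hom.add[OF assms] module_hom.scale[OF assms] module_hom.zero[OF assms] by blast+

lemma bracket_of_table_nth:
  "bracket_of_table c x y $ k = (\<Sum>i\<in>UNIV. \<Sum>j\<in>UNIV. x $ i * y $ j * c i j $ k)"
  by (simp add: bracket_of_table_def)

lemma bilinear_bracket_of_table: "bilinear_bracket (bracket_of_table c)"
  unfolding bilinear_bracket_def
  by (intro allI conjI module_hom_vecI)
     (simp_all add: vec_eq_iff bracket_of_table_nth algebra_simps sum.distrib sum_distrib_left)

lemma bracket_of_table_axis: "bracket_of_table c (axis a 1) (axis b 1) = c a b"
proof -
  \<comment> \<open>Testing \<open>j\<close> before \<open>i\<close> matches the order of summation,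
    so both sums collapse in turn.\<close>
  have "axis a 1 $ i * axis b 1 $ j * u = (if j = b then if i = a then u else 0 else 0)"
    for i j and u :: 'a
    by (simp add: axis_def)
  then show ?thesis
    by (simp add: vec_eq_iff bracket_of_table_nth)
qed

lemma leibniz_isoI:
  assumes "\<And>x y. f (x + y) = f x + f y" "\<And>c x. f (c *s x) = c *s f x"
    and "\<And>x. g (f x) = x" "\<And>x. f (g x) = x"
    and "\<And>x y. f (b x y) = b' (f x) (f y)"
  shows "b \<cong>\<^sub>L b'"
proof -
  have "bij f"
    by (rule o_bij[of g]) (simp_all add: assms fun_eq_iff)
  then show ?thesis
    unfolding leibniz_iso_def using module_hom_vecI[of f, OF assms(1,2)] assms(5) by auto
qed

text \<open>Gives the Leibniz identity for the targets by transport, so that it is never checked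
  inside a direct sum.\<close>

lemma left_leibniz_iso:
  assumes "left_leibniz b" "b \<cong>\<^sub>L b'"
  shows "left_leibniz b'"
proof -
  obtain f where f: "module_hom (*s) (*s) f" "bij f" "\<And>x y. f (b x y) = b' (f x) (f y)"
    using assms(2) unfolding leibniz_iso_def by blast
  note lin = module_hom_vecD[OF f(1)]
  have surj: "\<exists>u. v = f u" for v
    using bij_is_surj[OF f(2)] by blast
  have bil: "module_hom (*s) (*s) (b u)" "module_hom (*s) (*s) (\<lambda>v. b v u)" for u
    using assms(1) unfolding left_leibniz_def bilinear_bracket_def by blast+
  have "b' x (y + z) = b' x y + b' x z" "b' (y + z) x = b' y x + b' z x"
    "b' x (c *s y) = c *s b' x y" "b' (c *s y) x = c *s b' y x" for x y z c
  proof -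
    obtain u v w where "x = f u" "y = f v" "z = f w"
      using surj by metis
    then show "b' x (y + z) = b' x y + b' x z" "b' (y + z) x = b' y x + b' z x"
      "b' x (c *s y) = c *s b' x y" "b' (c *s y) x = c *s b' y x"
      by (simp_all add: module_hom_vecD(1,2)[OF bil(1)] module_hom_vecD(1,2)[OF bil(2)]
          flip: f(3) lin(1,2))
  qed
  then have "bilinear_bracket b'"
    unfolding bilinear_bracket_def by (blast intro: module_hom_vecI)
  moreover have "b' x (b' y z) = b' (b' x y) z + b' y (b' x z)" for x y z
  proof -
    obtain u v w where uvw: "x = f u" "y = f v" "z = f w"
      using surj by metis
    have "f (b u (b v w)) = f (b (b u v) w + b v (b u w))"
      using assms(1) unfolding left_leibniz_def by metis
    then show ?thesis
      by (simp add: uvw f(3) lin(1))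
  qed
  ultimately show ?thesis
    unfolding left_leibniz_def by blast
qed

section \<open>Deformations linear in the parameter\<close>

text \<open>
  The structure constants are integers so that the same bracket makes sense over \<open>\<complex>\<close> at a number
  \<open>t\<close> and over \<open>\<complex>[[t]]\<close> at the indeterminate.
\<close>

definition pencil ::
    "('n::finite \<Rightarrow> 'n \<Rightarrow> int ^ 'n) \<Rightarrow> ('n \<Rightarrow> 'n \<Rightarrow> int ^ 'n) \<Rightarrow> 'a::comm_ring_1 \<Rightarrow> ('a, 'n) bracket"
  where "pencil c d s = bracket_of_table (\<lambda>i j. \<chi> k. of_int (c i j $ k) + s * of_int (d i j $ k))"

definition pencil_coeff ::
    "('n::finite \<Rightarrow> 'n \<Rightarrow> int ^ 'n) \<Rightarrow> ('n \<Rightarrow> 'n \<Rightarrow> int ^ 'n) \<Rightarrow> nat \<Rightarrow> (complex, 'n) bracket"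
  where "pencil_coeff c d n = bracket_of_table (\<lambda>i j. \<chi> k.
    of_int (if n = 0 then c i j $ k else if n = 1 then d i j $ k else 0))"

lemma pencil_nth:
  "pencil c d s x y $ k =
    (\<Sum>i\<in>UNIV. \<Sum>j\<in>UNIV. x $ i * y $ j * (of_int (c i j $ k) + s * of_int (d i j $ k)))"
  by (simp add: pencil_def bracket_of_table_nth)

lemma pencil_coeff_0: "pencil_coeff c d 0 = pencil c d 0"
  by (simp add: pencil_coeff_def pencil_def)

text \<open>Reduces the formal Leibniz identity to the instance \<open>s = fps_X\<close> of an
  identity valid over every commutative ring.\<close>

lemma formal_bracket_pencil: "formal_bracket (pencil_coeff c d) = pencil c d fps_X"
proof -
  have "Abs_fps (\<lambda>n. pencil_coeff c d n (axis i 1) (axis j 1) $ k) =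
      of_int (c i j $ k) + fps_X * of_int (d i j $ k)" for i j k
  proof (rule fps_ext)
    fix n
    show "fps_nth (Abs_fps (\<lambda>n. pencil_coeff c d n (axis i 1) (axis j 1) $ k)) n =
        fps_nth (of_int (c i j $ k) + fps_X * of_int (d i j $ k)) n"
      unfolding pencil_coeff_def bracket_of_table_axis by simp
  qed
  then show ?thesis
    unfolding formal_bracket_def pencil_def by presburger
qed

lemma pencil_coeff_eq_0:
  assumes "n \<noteq> 0" "n \<noteq> 1"
  shows "pencil_coeff c d n = (\<lambda>x y. 0)"
proof -
  have "pencil_coeff c d n = bracket_of_table (\<lambda>i j. 0)"
    unfolding pencil_coeff_def using assms by (simp add: zero_vec_def)
  then show ?thesis
    by (simp add: bracket_of_table_def fun_eq_iff)
qed

lemma pencil_coeff_support: "{n. pencil_coeff c d n \<noteq> (\<lambda>x y. 0)} \<subseteq> {0, 1}"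
  by (rule subsetI, rule ccontr) (simp add: pencil_coeff_eq_0)

lemma eval_pencil: "eval_deformation (pencil_coeff c d) t = pencil c d t"
proof (intro ext)
  fix x y
  \<comment> \<open>The support may be smaller than \<open>{0, 1}\<close>; the terms added to the
    sum are zero.\<close>
  have "eval_deformation (pencil_coeff c d) t x y = (\<Sum>n\<in>{0, 1}. t ^ n *s pencil_coeff c d n x y)"
    unfolding eval_deformation_def
    by (rule sum.mono_neutral_left[OF _ pencil_coeff_support]) auto
  also have "\<dots> = pencil c d t x y"
    by (simp add: vec_eq_iff pencil_coeff_def pencil_nth bracket_of_table_nth sum.distrib
        sum_distrib_left algebra_simps)
  finally show "eval_deformation (pencil_coeff c d) t x y = pencil c d t x y" .
qed

text \<open>The parameter 0 gives the undeformed algebra, \<open>fps_X\<close> the formal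
  deformation, and 1 a copy of the target.\<close>

lemma deforms_via_pencil:
  assumes "left_leibniz (pencil c d (0::complex))" "left_leibniz (pencil c d (1::complex))"
    and "left_leibniz (pencil c d (fps_X::complex fps))"
    and iso: "\<And>t. t \<noteq> 0 \<Longrightarrow> pencil c d t \<cong>\<^sub>L \<nu>"
  shows "deforms_via (pencil_coeff c d) (pencil c d 0) \<nu>"
proof -
  have "finite {n. pencil_coeff c d n \<noteq> (\<lambda>x y. 0)}"
    by (rule finite_subset[OF pencil_coeff_support]) simp
  moreover have "leibniz \<nu>"
    using left_leibniz_iso[OF assms(2) iso] by (simp add: leibniz_def)
  moreover have "\<forall>\<^sub>F t in at 0. eval_deformation (pencil_coeff c d) t \<cong>\<^sub>L \<nu>"
    by (rule eventually_mono[OF eventually_neq_at_within[of 0]]) (simp add: eval_pencil iso)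
  moreover have "bilinear_bracket (pencil_coeff c d n)" for n
    by (simp add: pencil_coeff_def bilinear_bracket_of_table)
  ultimately show ?thesis
    using assms(1,3)
    by (simp add: deforms_via_def polynomial_deformation_def formal_deformation_def leibniz_def
        formal_bracket_pencil pencil_coeff_0)
qed

section \<open>The three kinds of deformed brackets\<close>

definition square_table :: "'n \<Rightarrow> 'n \<Rightarrow> 'n \<Rightarrow> 'n \<Rightarrow> int ^ 'n::finite" where
  "square_table p q i j = (if i = p \<and> j = p then axis q 1 else 0)"

lemma square_pencil_nth:
  "pencil (square_table a b) (square_table p q) s x y $ k =
    (if k = b then x $ a * y $ a else 0) + (if k = q then s * (x $ p * y $ p) else 0)"
proof -
  have "x $ i * y $ j * (of_int (square_table a b i j $ k) + s * of_int (square_table p q i j $ k)) =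
      (if j = a then if i = a then if k = b then x $ a * y $ a else 0 else 0 else 0) +
      (if j = p then if i = p then if k = q then s * (x $ p * y $ p) else 0 else 0 else 0)" for i j
    by (auto simp: square_table_def axis_def algebra_simps)
  then show ?thesis
    by (simp add: pencil_nth sum.distrib)
qed

text \<open>Products have zero coordinates at \<open>a\<close> and \<open>p\<close>, the only ones
  the bracket reads, so all double products vanish.\<close>

lemma left_leibniz_square_pencil:
  assumes "b \<noteq> a" "b \<noteq> p" "q \<noteq> a" "q \<noteq> p"
  shows "left_leibniz (pencil (square_table a b) (square_table p q) s)"
  using assms
  by (auto simp: left_leibniz_def vec_eq_iff square_pencil_nth)
     (simp add: pencil_def bilinear_bracket_of_table)

text \<open>At parameter 0 the direction \<open>d\<close> is arbitrary, so each deformation can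
  supply its own.\<close>

lemma lambda2_C2_eq_pencil: "lambda2_C2 = pencil (square_table 1 3) d 0"
  by (simp add: lambda2_C2_def pencil_def square_table_def)
     (intro arg_cong[of _ _ bracket_of_table] ext, simp add: vec_eq_iff axis_def)

lemma mu1_nth: "mu1 x y $ 1 = 0" "mu1 x y $ 2 = x $ 1 * y $ 1"
  by (simp_all add: mu1_def bracket_of_table_nth sum_2 axis_def)

lemma R20_0_nth:
  "R20_0 x y $ 1 = 0" "R20_0 x y $ 2 = 0"
  "R20_0 x y $ 3 = x $ 2 * y $ 2" "R20_0 x y $ 4 = x $ 1 * y $ 2 + x $ 2 * y $ 1"
  by (simp_all add: R20_0_def bracket_of_table_nth sum_4 axis_def)

lemma L2_nth:
  "L2 x y $ 1 = x $ 1 * y $ 4 - x $ 4 * y $ 1"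
  "L2 x y $ 2 = x $ 4 * y $ 2 - x $ 2 * y $ 4"
  "L2 x y $ 3 = x $ 1 * y $ 2 - x $ 2 * y $ 1 + x $ 4 * y $ 4"
  "L2 x y $ 4 = 0"
  by (simp_all add: L2_def bracket_of_table_nth sum_4 axis_def)

definition R20_table :: "5 \<Rightarrow> 5 \<Rightarrow> int ^ 5" where
  "R20_table i j = (if i = 1 \<and> j = 2 \<or> i = 2 \<and> j = 1 then axis 4 1 else 0)"

lemma R20_pencil_nth:
  fixes s :: "'a::comm_ring_1"
  defines "b \<equiv> pencil (square_table 1 3) R20_table s"
  shows "b x y $ 1 = 0" "b x y $ 2 = 0" "b x y $ 3 = x $ 1 * y $ 1"
    "b x y $ 4 = s * (x $ 1 * y $ 2 + x $ 2 * y $ 1)" "b x y $ 5 = 0"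
  by (simp_all add: b_def pencil_nth square_table_def R20_table_def sum_5 axis_def algebra_simps)

text \<open>The bracket reads only coordinates 1 and 2, which vanish on products, so double products
  are zero.\<close>

lemma left_leibniz_R20_pencil: "left_leibniz (pencil (square_table 1 3) R20_table s)"
  by (simp add: left_leibniz_def vec_eq_iff forall_5 R20_pencil_nth)
     (simp add: pencil_def bilinear_bracket_of_table)

text \<open>
  The basis \<open>t\<^sup>-\<^sup>3 e\<^sub>2, e\<^sub>4, t\<^sup>-\<^sup>2 e\<^sub>3, t\<^sup>-\<^sup>1 e\<^sub>1\<close> satisfies the relations of \<open>\<LL>\<^sub>2\<close>: the last vector
  fixes the scale \<open>t\<^sup>-\<^sup>2\<close> of its square, and then \<open>[e\<^sub>2, e\<^sub>4] = t e\<^sub>3\<close> forces the exponent \<open>-3\<close>.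
\<close>

definition L2_table :: "5 \<Rightarrow> 5 \<Rightarrow> int ^ 5" where
  "L2_table i j =
    (if i = 2 \<and> j = 1 then axis 2 1
     else if i = 1 \<and> j = 2 then - axis 2 1
     else if i = 1 \<and> j = 4 then axis 4 1
     else if i = 4 \<and> j = 1 then - axis 4 1
     else if i = 2 \<and> j = 4 then axis 3 1
     else if i = 4 \<and> j = 2 then - axis 3 1
     else 0)"

lemma L2_pencil_nth:
  fixes s :: "'a::comm_ring_1"
  defines "b \<equiv> pencil (square_table 1 3) L2_table s"
  shows "b x y $ 1 = 0" "b x y $ 2 = s * (x $ 2 * y $ 1 - x $ 1 * y $ 2)"
    "b x y $ 3 = x $ 1 * y $ 1 + s * (x $ 2 * y $ 4 - x $ 4 * y $ 2)"
    "b x y $ 4 = s * (x $ 1 * y $ 4 - x $ 4 * y $ 1)" "b x y $ 5 = 0"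
  by (simp_all add: b_def pencil_nth square_table_def L2_table_def sum_5 axis_def algebra_simps)

text \<open>The part with factor \<open>s\<close> is a Lie bracket: up to that factor e_1 acts on
  e_2, e_4 and e_3 = [e_2, e_4] with weights -1, 1 and 0. The square of e_1 adds nothing to double
  products, since e_3 is central and products have no e_1 coordinate.\<close>

lemma left_leibniz_L2_pencil: "left_leibniz (pencil (square_table 1 3) L2_table s)"
  by (simp add: left_leibniz_def vec_eq_iff forall_5 L2_pencil_nth algebra_simps)
     (simp add: pencil_def bilinear_bracket_of_table)

section \<open>Isomorphisms at nonzero parameter and the resulting deformations\<close>

lemma L2_pencil_iso:
  assumes "t \<noteq> 0"
  shows "pencil (square_table 1 3) L2_table t \<cong>\<^sub>L L2 \<oplus>\<^sub>L abelian1"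
proof (rule leibniz_isoI)
  let ?f = "\<lambda>x :: complex ^ 5. \<chi> i :: 4 + 1. case i of
    Inl k \<Rightarrow> if k = 1 then t ^ 3 * x $ 2 else if k = 2 then x $ 4
      else if k = 3 then t\<^sup>2 * x $ 3 else t * x $ 1
  | Inr k \<Rightarrow> x $ 5"
  let ?g = "\<lambda>y :: complex ^ (4 + 1). \<chi> i :: 5.
    if i = 1 then y $ Inl 4 / t else if i = 2 then y $ Inl 1 / t ^ 3
    else if i = 3 then y $ Inl 3 / t\<^sup>2 else if i = 4 then y $ Inl 2 else y $ Inr 1"
  show "?f (x + y) = ?f x + ?f y" for x y
    by (simp add: vec_eq_iff split_sum_all algebra_simps)
  show "?f (c *s x) = c *s ?f x" for c x
    by (simp add: vec_eq_iff split_sum_all)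
  show "?g (?f x) = x" for x
    using assms by (simp add: vec_eq_iff forall_5)
  show "?f (?g y) = y" for y
    using assms by (simp add: vec_eq_iff split_sum_all forall_4)
  show "?f (pencil (square_table 1 3) L2_table t x y) = (L2 \<oplus>\<^sub>L abelian1) (?f x) (?f y)" for x y
    by (simp add: vec_eq_iff split_sum_all forall_4 direct_sum_def L2_nth L2_pencil_nth
        abelian1_def algebra_simps power2_eq_square power3_eq_cube)
qed

text \<open>The basis e_2, e_1, e_3, t e_4 satisfies the relations of \<open>R20_0\<close>, and e_5
  spans the abelian summand.\<close>

lemma R20_pencil_iso:
  assumes "t \<noteq> 0"
  shows "pencil (square_table 1 3) R20_table t \<cong>\<^sub>L R20_0 \<oplus>\<^sub>L abelian1"
proof (rule leibniz_isoI)
  let ?f = "\<lambda>x :: complex ^ 5. \<chi> i :: 4 + 1. case i of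
    Inl k \<Rightarrow> if k = 1 then x $ 2 else if k = 2 then x $ 1
      else if k = 3 then x $ 3 else x $ 4 / t
  | Inr k \<Rightarrow> x $ 5"
  let ?g = "\<lambda>y :: complex ^ (4 + 1). \<chi> i :: 5.
    if i = 1 then y $ Inl 2 else if i = 2 then y $ Inl 1
    else if i = 3 then y $ Inl 3 else if i = 4 then t * y $ Inl 4 else y $ Inr 1"
  show "?f (x + y) = ?f x + ?f y" for x y
    by (simp add: vec_eq_iff split_sum_all add_divide_distrib)
  show "?f (c *s x) = c *s ?f x" for c x
    by (simp add: vec_eq_iff split_sum_all)
  show "?g (?f x) = x" for x
    using assms by (simp add: vec_eq_iff forall_5)
  show "?f (?g y) = y" for y
    using assms by (simp add: vec_eq_iff split_sum_all forall_4)
  show "?f (pencil (square_table 1 3) R20_table t x y) = (R20_0 \<oplus>\<^sub>L abelian1) (?f x) (?f y)"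
    for x y
    using assms by (simp add: vec_eq_iff split_sum_all forall_4 direct_sum_def R20_0_nth
        R20_pencil_nth abelian1_def add.commute)
qed

text \<open>The two copies of \<open>mu1\<close> have bases e_1, e_3 and e_p, t e_q; the remaining
  e_r spans the abelian summand.\<close>

lemma square_pencil_iso:
  fixes p q r :: 5
  assumes "t \<noteq> 0" and dist: "distinct [1, 3, p, q, r]"
  shows "pencil (square_table 1 3) (square_table p q) t \<cong>\<^sub>L mu1 \<oplus>\<^sub>L mu1 \<oplus>\<^sub>L abelian1"
proof (rule leibniz_isoI)
  let ?f = "\<lambda>x :: complex ^ 5. \<chi> i :: (2 + 2) + 1. case i of
    Inl (Inl k) \<Rightarrow> if k = 1 then x $ 1 else x $ 3
  | Inl (Inr k) \<Rightarrow> if k = 1 then x $ p else x $ q / t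
  | Inr k \<Rightarrow> x $ r"
  let ?g = "\<lambda>y :: complex ^ ((2 + 2) + 1). \<chi> i :: 5.
    if i = 1 then y $ Inl (Inl 1) else if i = 3 then y $ Inl (Inl 2)
    else if i = p then y $ Inl (Inr 1) else if i = q then t * y $ Inl (Inr 2) else y $ Inr 1"
  \<comment> \<open>Five distinct indices exhaust the type, so equality of vectors can be tested at
    these.\<close>
  have "set [1, 3, p, q, r] = UNIV"
    by (rule card_subset_eq) (use distinct_card[OF dist] in simp_all)
  then have all: "(\<forall>i. P i) \<longleftrightarrow> P 1 \<and> P 3 \<and> P p \<and> P q \<and> P r" for P
    by (metis UNIV_I empty_iff empty_set insert_iff list.simps(15))
  show "?f (x + y) = ?f x + ?f y" for x y
    by (simp add: vec_eq_iff split_sum_all add_divide_distrib)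
  show "?f (c *s x) = c *s ?f x" for c x
    by (simp add: vec_eq_iff split_sum_all)
  show "?g (?f x) = x" for x
    unfolding vec_eq_iff all using assms by auto
  show "?f (?g y) = y" for y
    using assms by (auto simp add: vec_eq_iff split_sum_all forall_2)
  show "?f (pencil (square_table 1 3) (square_table p q) t x y) =
      (mu1 \<oplus>\<^sub>L mu1 \<oplus>\<^sub>L abelian1) (?f x) (?f y)" for x y
    using assms by (auto simp add: vec_eq_iff split_sum_all forall_2 direct_sum_def mu1_nth
        square_pencil_nth abelian1_def)
qed

lemma deforms_to_L2: "deforms_to lambda2_C2 (L2 \<oplus>\<^sub>L abelian1)"
  unfolding deforms_to_def lambda2_C2_eq_pencil[of L2_table]
  by (rule exI, rule deforms_via_pencil) (simp_all add: left_leibniz_L2_pencil L2_pencil_iso)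

lemma deforms_to_R20_0: "deforms_to lambda2_C2 (R20_0 \<oplus>\<^sub>L abelian1)"
  unfolding deforms_to_def lambda2_C2_eq_pencil[of R20_table]
  by (rule exI, rule deforms_via_pencil) (simp_all add: left_leibniz_R20_pencil R20_pencil_iso)

section \<open>Independence modulo coboundaries\<close>

lemma coboundary_lambda2_C2_diag:
  assumes "module_hom (*s) (*s) f" "p \<noteq> 1"
  shows "coboundary lambda2_C2 f (axis p 1) (axis p 1) = 0"
proof -
  have "lambda2_C2 x y = 0" if "x $ 1 = 0 \<or> y $ 1 = 0" for x y
    using that unfolding lambda2_C2_eq_pencil[of "square_table 1 3"]
    by (auto simp: vec_eq_iff square_pencil_nth)
  then show ?thesis
    using assms module_hom_vecD(3)[OF assms(1)] by (simp add: coboundary_def axis_def)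
qed

lemma pencil_coeff_1_axis:
  "pencil_coeff (square_table a b) (square_table p q) 1 (axis i 1) (axis i 1) =
    (if i = p then axis q 1 else 0)"
  unfolding pencil_coeff_def bracket_of_table_axis
  by (simp add: square_table_def vec_eq_iff axis_def)

text \<open>Evaluating at e_p twice, with p = \<open>p l\<close>, and reading coordinate
  \<open>q l\<close> isolates the coefficient \<open>c l\<close>.\<close>

lemma independent_square_infinitesimals:
  fixes p q :: "nat \<Rightarrow> 5"
  assumes inj: "inj_on (\<lambda>k. (p k, q k)) {..<N}" and p: "\<And>k. k < N \<Longrightarrow> p k \<noteq> 1"
  shows "independent_mod_coboundaries lambda2_C2 N
    (\<lambda>k. pencil_coeff (square_table 1 3) (square_table (p k) (q k)) 1)"
  unfolding independent_mod_coboundaries_def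
proof (intro allI impI)
  fix c :: "nat \<Rightarrow> complex" and l
  let ?\<psi> = "\<lambda>k. pencil_coeff (square_table 1 3) (square_table (p k) (q k)) 1"
  assume "\<exists>f. module_hom (*s) (*s) f \<and>
    (\<lambda>x y. \<Sum>k<N. c k *s ?\<psi> k x y) = coboundary lambda2_C2 f" and l: "l < N"
  then obtain f where "module_hom (*s) (*s) f"
    and eq: "(\<lambda>x y. \<Sum>k<N. c k *s ?\<psi> k x y) = coboundary lambda2_C2 f"
    by blast
  let ?e = "axis (p l) 1 :: complex ^ 5"
  have "0 = coboundary lambda2_C2 f ?e ?e $ q l"
    using coboundary_lambda2_C2_diag[OF \<open>module_hom (*s) (*s) f\<close> p[OF l]] by simp
  also have "\<dots> = (\<Sum>k<N. c k * ?\<psi> k ?e ?e $ q l)"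
    by (simp flip: eq)
  also have "\<dots> = (\<Sum>k<N. c k * (if p l = p k then axis (q k) 1 else 0) $ q l)"
    by (simp only: pencil_coeff_1_axis)
  \<comment> \<open>By injectivity only \<open>k = l\<close> matches in both \<open>p\<close> and
    \<open>q\<close>.\<close>
  also have "\<dots> = (\<Sum>k<N. if k = l then c k else 0)"
    using inj l by (intro sum.cong) (auto simp: axis_def inj_on_def)
  finally show "c l = 0"
    using l by simp
qed

theorem theorem5p10:
  "deforms_in_ways 6 lambda2_C2 (mu1 \<oplus>\<^sub>L mu1 \<oplus>\<^sub>L abelian1)
   \<and> deforms_to lambda2_C2 (L2 \<oplus>\<^sub>L abelian1)
   \<and> deforms_to lambda2_C2 (R20_0 \<oplus>\<^sub>L abelian1)"
proof (intro conjI deforms_to_L2 deforms_to_R20_0)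
  \<comment> \<open>The six ordered pairs of distinct elements of {2, 4, 5}; \<open>?r\<close> is
    the element left over.\<close>
  let ?p = "\<lambda>k. [2, 2, 4, 4, 5, 5 :: 5] ! k" and ?q = "\<lambda>k. [4, 5, 2, 5, 2, 4 :: 5] ! k"
    and ?r = "\<lambda>k. [5, 4, 5, 2, 4, 2 :: 5] ! k"
  have less_6: "k < 6 \<longleftrightarrow> k \<in> {0, 1, 2, 3, 4, 5}" for k :: nat
    by (auto simp: numeral_eq_Suc less_Suc_eq)
  have distinct: "distinct [1, 3, ?p k, ?q k, ?r k]" if "k < 6" for k
    using that unfolding less_6 by (elim insertE emptyE) simp_all
  have "deforms_via (pencil_coeff (square_table 1 3) (square_table (?p k) (?q k))) lambda2_C2
      (mu1 \<oplus>\<^sub>L mu1 \<oplus>\<^sub>L abelian1)" if "k < 6" for k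
  proof -
    have "3 \<noteq> ?p k" "?q k \<noteq> 1" "?q k \<noteq> ?p k"
      using distinct[OF that] by auto
    note leibniz = left_leibniz_square_pencil[OF _ this]
    show ?thesis
      unfolding lambda2_C2_eq_pencil[of "square_table (?p k) (?q k)"]
      by (rule deforms_via_pencil)
        (simp_all add: leibniz square_pencil_iso[OF _ distinct[OF that]])
  qed
  moreover have "independent_mod_coboundaries lambda2_C2 6
      (\<lambda>k. pencil_coeff (square_table 1 3) (square_table (?p k) (?q k)) 1)"
  proof (rule independent_square_infinitesimals)
    show "inj_on (\<lambda>k. (?p k, ?q k)) {..<6}"
      by (auto simp: inj_on_def less_6)
    show "?p k \<noteq> 1" if "k < 6" for k
      using distinct[OF that] by auto
  qed
  ultimately show "deforms_in_ways 6 lambda2_C2 (mu1 \<oplus>\<^sub>L mu1 \<oplus>\<^sub>L abelian1)"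
    unfolding deforms_in_ways_def
    by (intro exI[of _ "\<lambda>k. pencil_coeff (square_table 1 3) (square_table (?p k) (?q k))"]
        conjI allI impI)
qed

end
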